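(* Let $A, Q, X_0 \in \mathbb{R}^{d\times d}$ with $Q$ and $X_0$ symmetric and positive semidefinite, let $1 \le r \le d$, let $\tau > 0$ and $t_0 < T$, and let the low-rank split-step integrator described in the context be applied to the differential Lyapunov equation $\dot X(t) = AX(t) + X(t)A^{\mathsf T} + Q$, $X(t_0) = X_0$, $t\in[t_0,T]$, starting from $U_0 S_0 U_0^{\mathsf T}$, where $U_0 \in \mathbb{R}^{d\times r}$ has orthonormal columns and $S_0\in\mathbb{R}^{r\times r}$ is symmetric and positive semidefinite. Then every matrix $S_n \in \mathbb{R}^{r\times r}$ ($n \ge 1$) produced in step (5c) of the integrator is symmetric and positive semidefinite.
   Context: All matrices are real and $(\cdot)^{\mathsf T}$ denotes the transpose. A QR decomposition of a matrix $W\in\mathbb{R}^{d\times r}$ means a (thin) factorization $W = UR$ with $U\in\mathbb{R}^{d\times r}$ having orthonormal columns (i.e. $U^{\mathsf T}U = I_r$) and $R\in\mathbb{R}^{r\times r}$ upper triangular. The first-order low-rank split-step integrator for the differential Lyapunov equation is the following algorithm. (1) Compute a symmetric rank-$r$ approximation $M_0 = U_0 S_0 U_0^{\mathsf T}$ to the initial data $X_0$, where $U_0\in\mathbb{R}^{d\times r}$ has orthonormal columns and $S_0\in\mathbb{R}^{r\times r}$ is symmetric and positive semidefinite. (2) Let $t_k = t_0 + k\tau$ for $k\in\mathbb{N}$ and set $n=0$. (3) Compute $\mathrm{e}^{\tau A}U_n$ and a QR decomposition $\mathrm{e}^{\tau A}U_n = U_n^A R$ with $U_n^A\in\mathbb{R}^{d\times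 r}$ having orthonormal columns and $R\in\mathbb{R}^{r\times r}$. (4) Define $S_n^A = R S_n R^{\mathsf T}$. (5) Given $U_n^A$ and $S_n^A$, perform one integration step: (5a) Solve the differential equation $\dot K(t) = Q U_n^A$ with initial value $K(t_n) = U_n^A S_n^A$. Compute a QR decomposition $K(t_{n+1}) = U_{n+1}\widehat S_{n+1}$, where $U_{n+1}\in\mathbb{R}^{d\times r}$ has orthonormal columns and $\widehat S_{n+1}\in\mathbb{R}^{r\times r}$. (5b) Solve $\dot S(t) = -U_{n+1}^{\mathsf T} Q U_n^A$ with initial value $S(t_n) = \widehat S_{n+1}$, and set $\widetilde S_n = S(t_{n+1})$. (5c) Solve $\dot L(t) = U_{n+1}^{\mathsf T} Q$ with initial value $L(t_n) = \widetilde S_n (U_n^A)^{\mathsf T}$, and set $S_{n+1} = L(t_{n+1})U_{n+1}$. (6) Increase $n$ by $1$. (7) Go to (3) and repeat as long as $t_n < T$. All differential equations in (5a)-(5c) have constant right-hand sides and are solved exactly. *)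

theory Defs
  imports "HOL-Analysis.Analysis"
begin

text \<open>Real \<open>d \<times> r\<close> matrices are elements of \<^typ>\<open>real^'r^'d\<close> with \<open>d = CARD('d)\<close>, \<open>r = CARD('r)\<close>.\<close>

definition symmetric_matrix :: "real^'n^'n \<Rightarrow> bool" where
  "symmetric_matrix M \<longleftrightarrow> transpose M = M"

definition psd_matrix :: "real^'n^'n \<Rightarrow> bool" where
  "psd_matrix M \<longleftrightarrow> (\<forall>x. 0 \<le> x \<bullet> (M *v x))"

text \<open>The product on square matrices is \<^term>\<open>(**)\<close>, not the multiplication of an algebra type class,
  so neither \<^term>\<open>(^)\<close> nor \<^const>\<open>exp\<close> applies to them.\<close>

primrec matrix_power :: "real^'n^'n \<Rightarrow> nat \<Rightarrow> real^'n^'n" where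
  "matrix_power A 0 = mat 1"
| "matrix_power A (Suc k) = A ** matrix_power A k"

definition matrix_exp :: "real^'n^'n \<Rightarrow> real^'n^'n" where
  "matrix_exp A = (\<Sum>k. (1 / fact k) *\<^sub>R matrix_power A k)"

definition orthonormal_columns :: "real^'r^'d \<Rightarrow> bool" where
  "orthonormal_columns U \<longleftrightarrow> transpose U ** U = mat 1"

text \<open>Triangularity needs an order on the column index. Every finite linear order of size \<open>r\<close>
  is isomorphic to \<open>{1..r}\<close>.\<close>

definition upper_triangular_matrix :: "real^('r::{finite,linorder})^('r::{finite,linorder}) \<Rightarrow> bool" where
  "upper_triangular_matrix R \<longleftrightarrow> (\<forall>i j. j < i \<longrightarrow> R $ i $ j = 0)"

definition qr_decomposition ::
    "real^('r::{finite,linorder})^'d \<Rightarrow> real^('r::{finite,linorder})^'d \<Rightarrow> real^('r::{finite,linorder})^('r::{finite,linorder}) \<Rightarrow> bool" where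
  "qr_decomposition W U R \<longleftrightarrow>
     W = U ** R \<and> orthonormal_columns U \<and> upper_triangular_matrix R"

definition solves_const_ivp ::
    "(real \<Rightarrow> 'a::real_normed_vector) \<Rightarrow> 'a \<Rightarrow> real \<Rightarrow> real \<Rightarrow> 'a \<Rightarrow> bool" where
  "solves_const_ivp Y F a b Y0 \<longleftrightarrow>
     Y a = Y0 \<and> (\<forall>t\<in>{a..b}. (Y has_vector_derivative F) (at t within {a..b}))"

text \<open>\<open>split_step A Q \<tau> a b U S U' S'\<close>: one pass through the loop of the integrator, over the time
  interval \<open>[a, b]\<close>, can turn the factors \<open>(U, S)\<close> into \<open>(U', S')\<close>. This is a relation rather than a
  function because QR decompositions are not unique.\<close>

definition split_step ::
    "real^'d^'d \<Rightarrow> real^'d^'d \<Rightarrow> real \<Rightarrow> real \<Rightarrow> real \<Rightarrow>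
     real^('r::{finite,linorder})^'d \<Rightarrow> real^('r::{finite,linorder})^('r::{finite,linorder}) \<Rightarrow> real^('r::{finite,linorder})^'d \<Rightarrow> real^('r::{finite,linorder})^('r::{finite,linorder}) \<Rightarrow> bool" where
  "split_step A Q \<tau> a b U S U' S' \<longleftrightarrow>
     (\<exists>UA R SA K Shat Ssol Stilde L.
        qr_decomposition (matrix_exp (\<tau> *\<^sub>R A) ** U) UA R \<and>
        SA = R ** S ** transpose R \<and>
        solves_const_ivp K (Q ** UA) a b (UA ** SA) \<and>
        qr_decomposition (K b) U' Shat \<and>
        solves_const_ivp Ssol (- (transpose U' ** Q ** UA)) a b Shat \<and>
        Stilde = Ssol b \<and>
        solves_const_ivp L (transpose U' ** Q) a b (Stilde ** transpose UA) \<and>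
        S' = L b ** U')"

definition time_grid :: "real \<Rightarrow> real \<Rightarrow> nat \<Rightarrow> real" where
  "time_grid t0 \<tau> k = t0 + real k * \<tau>"

text \<open>\<open>split_step_iterate A Q \<tau> t0 T U0 S0 n U S\<close>: some run of the integrator on \<open>[t0, T]\<close> started from
  \<open>(U0, S0)\<close> produces the factors \<open>U\<^sub>n = U\<close> and \<open>S\<^sub>n = S\<close>.\<close>

inductive split_step_iterate ::
    "real^'d^'d \<Rightarrow> real^'d^'d \<Rightarrow> real \<Rightarrow> real \<Rightarrow> real \<Rightarrow>
     real^('r::{finite,linorder})^'d \<Rightarrow> real^('r::{finite,linorder})^('r::{finite,linorder}) \<Rightarrow> nat \<Rightarrow> real^('r::{finite,linorder})^'d \<Rightarrow> real^('r::{finite,linorder})^('r::{finite,linorder}) \<Rightarrow> bool"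
  for A Q \<tau> t0 T U0 S0 where
  start: "split_step_iterate A Q \<tau> t0 T U0 S0 0 U0 S0"
| step: "split_step_iterate A Q \<tau> t0 T U0 S0 n U S \<Longrightarrow> time_grid t0 \<tau> n < T \<Longrightarrow>
         split_step A Q \<tau> (time_grid t0 \<tau> n) (time_grid t0 \<tau> (Suc n)) U S U' S' \<Longrightarrow>
         split_step_iterate A Q \<tau> t0 T U0 S0 (Suc n) U' S'"

end

theory Submission
  imports Defs
begin

text \<open>
  Write \<open>h = b - a \<ge> 0\<close> for the length of the time interval \<open>[a, b]\<close> of one step. The
  right-hand sides of the three substeps are constant, so each substep adds \<open>h\<close> times its right-hand side to
  the initial value. From \<open>U' Shat = UA SA + h Q UA\<close> and \<open>U'\<^sup>T U' = I\<close> one reads off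
  \<open>Shat = U'\<^sup>T UA SA + h U'\<^sup>T Q UA\<close>. The
  middle substep runs with a negative sign and subtracts exactly the second summand, so that
  \<open>Stilde = U'\<^sup>T UA SA\<close>. The last substep then gives
  \<open>S' = (UA\<^sup>T U')\<^sup>T SA (UA\<^sup>T U') + h U'\<^sup>T Q U'\<close> (lemma \<open>split_step_closed_form\<close>).

  Here \<open>SA = R S R\<^sup>T\<close>, so \<open>S'\<close> is a nonnegative combination of congruence transforms of \<open>S\<close> and \<open>Q\<close>.
  Congruence, addition and nonnegative scaling all preserve symmetry and positive semidefiniteness,
  also for rectangular transformation matrices, and the claim follows by induction on the steps.
\<close>

lemma transpose_matrix_add:
  fixes M N :: "real^'n^'m"
  shows "transpose (M + N) = transpose M + transpose N"
  by (simp add: transpose_def vec_eq_iff)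

lemma matrix_add_rdistrib:
  fixes M N :: "real^'n^'m" and P :: "real^'k^'n"
  shows "(M + N) ** P = M ** P + N ** P"
  by (simp add: matrix_matrix_mult_def vec_eq_iff distrib_right sum.distrib)

lemma symmetric_matrix_add:
  assumes "symmetric_matrix M" "symmetric_matrix N"
  shows "symmetric_matrix (M + N)"
  using assms by (simp add: symmetric_matrix_def transpose_matrix_add)

lemma symmetric_matrix_scaleR:
  assumes "symmetric_matrix M"
  shows "symmetric_matrix (c *\<^sub>R M)"
  using assms by (simp add: symmetric_matrix_def transpose_scalar)

lemma symmetric_matrix_congruence:
  fixes P :: "real^'m^'n"
  assumes "symmetric_matrix M"
  shows "symmetric_matrix (transpose P ** M ** P)"
  using assms by (simp add: symmetric_matrix_def matrix_transpose_mul matrix_mul_assoc)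

lemma psd_matrix_add:
  assumes "psd_matrix M" "psd_matrix N"
  shows "psd_matrix (M + N)"
  using assms by (simp add: psd_matrix_def matrix_vector_mult_add_rdistrib inner_add_right)

lemma psd_matrix_scaleR:
  assumes "psd_matrix M" "0 \<le> c"
  shows "psd_matrix (c *\<^sub>R M)"
  using assms by (simp add: psd_matrix_def scaleR_matrix_vector_assoc[symmetric])

text \<open>The quadratic form of the transformed matrix at \<open>x\<close> is that of \<open>M\<close> at \<open>P x\<close>.\<close>

lemma psd_matrix_congruence:
  fixes P :: "real^'m^'n"
  assumes "psd_matrix M"
  shows "psd_matrix (transpose P ** M ** P)"
  unfolding psd_matrix_def
proof
  fix x :: "real^'m"
  have "x \<bullet> ((transpose P ** M ** P) *v x) = x \<bullet> (transpose P *v (M *v (P *v x)))"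
    by (simp add: matrix_vector_mul_assoc matrix_mul_assoc)
  also have "\<dots> = (P *v x) \<bullet> (M *v (P *v x))"
    by (metis dot_lmul_matrix transpose_matrix_vector transpose_transpose)
  finally show "0 \<le> x \<bullet> ((transpose P ** M ** P) *v x)"
    using assms by (simp add: psd_matrix_def)
qed

text \<open>The difference between \<open>Y\<close> and the affine function \<open>t \<mapsto> (t - a) F\<close> has derivative zero.\<close>

lemma solves_const_ivp_endpoint:
  assumes "solves_const_ivp Y F a b Y0" and "a \<le> b"
  shows "Y b = Y0 + (b - a) *\<^sub>R F"
proof -
  have init: "Y a = Y0"
    and deriv: "\<And>t. t \<in> {a..b} \<Longrightarrow> (Y has_vector_derivative F) (at t within {a..b})"
    using assms(1) by (auto simp: solves_const_ivp_def)
  have "((\<lambda>t. Y t - (t - a) *\<^sub>R F) has_vector_derivative 0) (at t within {a..b})"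
    if "t \<in> {a..b}" for t
    using deriv[OF that] by (auto intro!: derivative_eq_intros)
  then obtain c where c: "\<And>t. t \<in> {a..b} \<Longrightarrow> Y t - (t - a) *\<^sub>R F = c"
    using has_vector_derivative_zero_constant[of "{a..b}" "\<lambda>t. Y t - (t - a) *\<^sub>R F"]
    by auto
  from c[of a] c[of b] show ?thesis
    using \<open>a \<le> b\<close> init by (simp add: algebra_simps)
qed

text \<open>The closed form in which \<open>Shat\<close> and \<open>Stilde\<close> have been eliminated. The matrix \<open>U'\<^sup>T Q UA\<close>,
  which need not be symmetric, enters once with each sign and cancels.\<close>

lemma split_step_closed_form:
  fixes U U' :: "real^('r::{finite,linorder})^'d"
  assumes "split_step A Q \<tau> a b U S U' S'" and "a \<le> b"
  obtains UA :: "real^('r::{finite,linorder})^'d"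
    and R :: "real^('r::{finite,linorder})^('r::{finite,linorder})" where
    "S' = transpose (transpose UA ** U') ** (R ** S ** transpose R) ** (transpose UA ** U')
          + (b - a) *\<^sub>R (transpose U' ** Q ** U')"
proof -
  define h where "h = b - a"
  obtain UA R SA K Shat Ssol L where
    SA: "SA = R ** S ** transpose R" and
    K: "solves_const_ivp K (Q ** UA) a b (UA ** SA)" and
    qr: "qr_decomposition (K b) U' Shat" and
    Ssol: "solves_const_ivp Ssol (- (transpose U' ** Q ** UA)) a b Shat" and
    L: "solves_const_ivp L (transpose U' ** Q) a b (Ssol b ** transpose UA)" and
    S': "S' = L b ** U'"
    using assms(1) unfolding split_step_def by (elim exE conjE) simp
  have K_end: "K b = UA ** SA + h *\<^sub>R (Q ** UA)"
    using solves_const_ivp_endpoint[OF K \<open>a \<le> b\<close>] by (simp add: h_def)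
  have "Shat = transpose U' ** (U' ** Shat)"
    using qr by (simp add: qr_decomposition_def orthonormal_columns_def matrix_mul_assoc)
  also have "\<dots> = transpose U' ** (UA ** SA + h *\<^sub>R (Q ** UA))"
    using qr K_end by (simp add: qr_decomposition_def)
  also have "\<dots> = transpose U' ** UA ** SA + h *\<^sub>R (transpose U' ** Q ** UA)"
    by (simp add: matrix_add_ldistrib matrix_mul_assoc matrix_scalar_ac
        scalar_matrix_assoc[symmetric])
  finally have "Ssol b = transpose U' ** UA ** SA"
    using solves_const_ivp_endpoint[OF Ssol \<open>a \<le> b\<close>] by (simp add: h_def)
  then have "L b = transpose U' ** UA ** SA ** transpose UA + h *\<^sub>R (transpose U' ** Q)"
    using solves_const_ivp_endpoint[OF L \<open>a \<le> b\<close>] by (simp add: h_def)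
  then have "S' = transpose (transpose UA ** U') ** SA ** (transpose UA ** U')
      + h *\<^sub>R (transpose U' ** Q ** U')"
    using S' by (simp add: matrix_add_rdistrib matrix_transpose_mul matrix_mul_assoc
        scalar_matrix_assoc[symmetric])
  then show thesis
    by (intro that[of UA R]) (simp add: SA h_def)
qed

lemma split_step_preserves_symmetric_psd:
  fixes U U' :: "real^('r::{finite,linorder})^'d"
  assumes "split_step A Q \<tau> a b U S U' S'" and "a \<le> b"
    and "symmetric_matrix Q" "psd_matrix Q"
    and "symmetric_matrix S" "psd_matrix S"
  shows "symmetric_matrix S' \<and> psd_matrix S'"
proof -
  obtain UA :: "real^('r::{finite,linorder})^'d"
    and R :: "real^('r::{finite,linorder})^('r::{finite,linorder})" where S': "S' =
      transpose (transpose UA ** U') ** (R ** S ** transpose R) ** (transpose UA ** U')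
      + (b - a) *\<^sub>R (transpose U' ** Q ** U')"
    by (rule split_step_closed_form[OF assms(1,2)])
  have SA: "symmetric_matrix (R ** S ** transpose R)" "psd_matrix (R ** S ** transpose R)"
    using symmetric_matrix_congruence[OF \<open>symmetric_matrix S\<close>, of "transpose R"]
      psd_matrix_congruence[OF \<open>psd_matrix S\<close>, of "transpose R"] by simp_all
  show ?thesis
    unfolding S'
    using SA assms
    by (intro conjI symmetric_matrix_add symmetric_matrix_scaleR symmetric_matrix_congruence
        psd_matrix_add psd_matrix_scaleR psd_matrix_congruence) simp_all
qed

theorem lemma1:
  fixes A Q X0 :: "real^'d^'d"
    and U0 U :: "real^('r::{finite,linorder})^'d"
    and S0 S :: "real^('r::{finite,linorder})^('r::{finite,linorder})"
    and \<tau> t0 T :: real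
    and n :: nat
  assumes "symmetric_matrix Q" and "psd_matrix Q"
    and "symmetric_matrix X0" and "psd_matrix X0"
    and "1 \<le> CARD('r)" and "CARD('r) \<le> CARD('d)"
    and "\<tau> > 0" and "t0 < T"
    and "orthonormal_columns U0"
    and "symmetric_matrix S0" and "psd_matrix S0"
    and "n \<ge> 1"
    and "split_step_iterate A Q \<tau> t0 T U0 S0 n U S"
  shows "symmetric_matrix S \<and> psd_matrix S"
proof -
  have grid: "time_grid t0 \<tau> k \<le> time_grid t0 \<tau> (Suc k)" for k
    using \<open>\<tau> > 0\<close> by (simp add: time_grid_def distrib_right)
  from \<open>split_step_iterate A Q \<tau> t0 T U0 S0 n U S\<close> show ?thesis
  proof (induction rule: split_step_iterate.induct)
    case start
    show ?case
      using \<open>symmetric_matrix S0\<close> \<open>psd_matrix S0\<close> by simp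
  next
    case (step n U S U' S')
    then show ?case
      using split_step_preserves_symmetric_psd grid \<open>symmetric_matrix Q\<close> \<open>psd_matrix Q\<close> by blast
  qed
qed

end
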